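(* Let $H_1,H_2$ be complex Hilbert spaces, let $K\in\mathcal K(H_1,H_2)$, $F\in\mathcal F(H_1,H_2)$, $\alpha\ge 0$, and let $V\in\mathcal B(H_1,H_2)$ be a partial isometry. Assume further that (1) $V\in\mathcal{AN}(H_1,H_2)$, and (2) $K^*K+\alpha(V^*K+K^*V)\ge 0$. Then $T:=K-F+\alpha V\in\mathcal{AN}(H_1,H_2)$.
   Context: $\mathcal B(H_1,H_2)$, $\mathcal K(H_1,H_2)$, $\mathcal F(H_1,H_2)$ denote the bounded, compact, and finite rank linear operators from $H_1$ to $H_2$. For a self-adjoint operator $A$, $A\ge 0$ means $\langle Ax,x\rangle\ge 0$ for all $x$. A partial isometry is an operator $V$ with $\|Vx\|=\|x\|$ for all $x\in N(V)^\perp$. An operator $T\in\mathcal B(H_1,H_2)$ is norm attaining if there is a unit vector $x\in H_1$ with $\|Tx\|=\|T\|$; it is absolutely norm attaining, written $T\in\mathcal{AN}(H_1,H_2)$, if the restriction $T|_M:M\to H_2$ is norm attaining for every nonzero closed subspace $M$ of $H_1$. *)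

theory Defs
  imports "HOL-Analysis.Analysis"
begin

text \<open>Complex Hilbert spaces: Banach spaces whose norm comes from a sesquilinear form that is
  linear in its first and conjugate-linear in its second argument. Positive definiteness of the
  form is a consequence of \<open>norm_eq_sqrt_cinner\<close>. The trivial space is included, and there is
  no separability assumption.\<close>

class chilbert_space = banach +
  fixes scaleC :: "complex \<Rightarrow> 'a \<Rightarrow> 'a"  (infixr \<open>*\<^sub>C\<close> 75)
    and cinner :: "'a \<Rightarrow> 'a \<Rightarrow> complex"
  assumes scaleC_add_right: "a *\<^sub>C (x + y) = a *\<^sub>C x + a *\<^sub>C y"
    and scaleC_add_left: "(a + b) *\<^sub>C x = a *\<^sub>C x + b *\<^sub>C x"
    and scaleC_scaleC: "a *\<^sub>C (b *\<^sub>C x) = (a * b) *\<^sub>C x"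
    and scaleR_eq_scaleC: "r *\<^sub>R x = complex_of_real r *\<^sub>C x"
    and cinner_commute: "cinner x y = cnj (cinner y x)"
    and cinner_add_left: "cinner (x + y) z = cinner x z + cinner y z"
    and cinner_scaleC_left: "cinner (a *\<^sub>C x) y = a * cinner x y"
    and norm_eq_sqrt_cinner: "norm x = sqrt (Re (cinner x x))"

lemma vector_space_scaleC:
  "vector_space (scaleC :: complex \<Rightarrow> 'a \<Rightarrow> 'a::chilbert_space)"
proof
  show "1 *\<^sub>C x = x" for x :: 'a
    using scaleR_eq_scaleC[of 1 x] by simp
qed (simp_all add: scaleC_add_right scaleC_add_left scaleC_scaleC)

global_interpretation cvs: vector_space "scaleC :: complex \<Rightarrow> 'a \<Rightarrow> 'a::chilbert_space"
  defines csubspace = cvs.subspace and cspan = cvs.span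
  by (rule vector_space_scaleC)

definition bounded_clinear :: "('a::chilbert_space \<Rightarrow> 'b::chilbert_space) \<Rightarrow> bool" where
  "bounded_clinear T \<longleftrightarrow> bounded_linear T \<and> (\<forall>c x. T (c *\<^sub>C x) = c *\<^sub>C T x)"

definition compact_op :: "('a::chilbert_space \<Rightarrow> 'b::chilbert_space) \<Rightarrow> bool" where
  "compact_op T \<longleftrightarrow> bounded_clinear T \<and> (\<forall>S. bounded S \<longrightarrow> compact (closure (T ` S)))"

definition finite_rank_op :: "('a::chilbert_space \<Rightarrow> 'b::chilbert_space) \<Rightarrow> bool" where
  "finite_rank_op T \<longleftrightarrow> bounded_clinear T \<and> (\<exists>B. finite B \<and> range T \<subseteq> cspan B)"

text \<open>For bounded operators between complex Hilbert spaces the operator selected below exists and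
  is unique, by the Riesz representation theorem.\<close>

definition cadjoint ::
    "('a::chilbert_space \<Rightarrow> 'b::chilbert_space) \<Rightarrow> 'b \<Rightarrow> 'a" where
  "cadjoint T = (SOME S. \<forall>x y. cinner (T x) y = cinner x (S y))"

text \<open>Membership in \<open>\<real>\<^sub>\<ge>\<^sub>0\<close> says that the complex number is real and nonnegative; over the complex
  scalars a bounded operator with a real quadratic form is automatically self-adjoint.\<close>

definition positive_op :: "('a::chilbert_space \<Rightarrow> 'a) \<Rightarrow> bool" where
  "positive_op A \<longleftrightarrow> bounded_clinear A \<and> (\<forall>x. cinner (A x) x \<in> \<real>\<^sub>\<ge>\<^sub>0)"

definition null_space :: "('a::chilbert_space \<Rightarrow> 'b::chilbert_space) \<Rightarrow> 'a set" where
  "null_space T = {x. T x = 0}"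

definition orth_compl :: "'a::chilbert_space set \<Rightarrow> 'a set" where
  "orth_compl S = {x. \<forall>y\<in>S. cinner x y = 0}"

definition partial_isometry :: "('a::chilbert_space \<Rightarrow> 'b::chilbert_space) \<Rightarrow> bool" where
  "partial_isometry V \<longleftrightarrow>
     bounded_clinear V \<and> (\<forall>x \<in> orth_compl (null_space V). norm (V x) = norm x)"

text \<open>The operator norm of the restriction of \<open>T\<close> to \<open>M\<close>; for \<open>M = UNIV\<close> this is \<^const>\<open>onorm\<close>
  (the point 0 contributes the value 0, since division by zero yields 0).\<close>

definition onorm_on :: "'a::chilbert_space set \<Rightarrow> ('a \<Rightarrow> 'b::chilbert_space) \<Rightarrow> real" where
  "onorm_on M T = (SUP x\<in>M. norm (T x) / norm x)"

definition norm_attaining_on ::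
    "'a::chilbert_space set \<Rightarrow> ('a \<Rightarrow> 'b::chilbert_space) \<Rightarrow> bool" where
  "norm_attaining_on M T \<longleftrightarrow> (\<exists>x\<in>M. norm x = 1 \<and> norm (T x) = onorm_on M T)"

definition absolutely_norm_attaining ::
    "('a::chilbert_space \<Rightarrow> 'b::chilbert_space) \<Rightarrow> bool" where
  "absolutely_norm_attaining T \<longleftrightarrow>
     bounded_clinear T \<and>
     (\<forall>M. csubspace M \<and> closed M \<and> M \<noteq> {0} \<longrightarrow> norm_attaining_on M T)"

end

theory Submission
  imports Defs
begin

text \<open>Since \<open>V\<close> is \<open>AN\<close>, its kernel or the orthogonal complement of its kernel is finite dimensional.
  In the second case \<open>V\<close> has finite rank, so \<open>T\<close> is compact. In the first case, every
  infinite-dimensional closed subspace \<open>M\<close> contains some \<open>x \<noteq> 0\<close> with \<open>F x = 0\<close> and \<open>x \<bottom> N(V)\<close>, and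
  the positivity hypothesis gives \<open>\<parallel>T x\<parallel> \<ge> \<alpha> \<parallel>V x\<parallel> = \<alpha> \<parallel>x\<parallel>\<close>. So the norm of \<open>T\<close> on \<open>M\<close> is either
  \<open>\<alpha>\<close>, attained at \<open>x\<close>, or larger than \<open>\<alpha>\<close>, and then a maximizing sequence has a convergent
  subsequence because \<open>K - F\<close> is compact and \<open>\<parallel>V\<parallel> \<le> 1\<close>.\<close>

section \<open>Geometry of the inner product\<close>

lemma cinner_add_right: "cinner x (y + z) = cinner x y + cinner x (z::'a::chilbert_space)"
  by (metis cinner_add_left cinner_commute complex_cnj_add)

lemma cinner_scaleC_right: "cinner x (a *\<^sub>C y) = cnj a * cinner x (y::'a::chilbert_space)"
  by (metis cinner_commute cinner_scaleC_left complex_cnj_mult)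

lemma additive_cinner_left: "Modules.additive (\<lambda>x::'a::chilbert_space. cinner x y)"
  by (rule Modules.additive.intro) (rule cinner_add_left)

lemma additive_cinner_right: "Modules.additive (\<lambda>y::'a::chilbert_space. cinner x y)"
  by (rule Modules.additive.intro) (rule cinner_add_right)

lemmas cinner_zero_left = Modules.additive.zero[OF additive_cinner_left]
  and cinner_diff_left = Modules.additive.diff[OF additive_cinner_left]
  and cinner_sum_left = Modules.additive.sum[OF additive_cinner_left]
  and cinner_zero_right = Modules.additive.zero[OF additive_cinner_right]
  and cinner_diff_right = Modules.additive.diff[OF additive_cinner_right]

lemmas cinner_simps = cinner_add_left cinner_add_right cinner_diff_left cinner_diff_right
  cinner_scaleC_left cinner_scaleC_right cinner_zero_left cinner_zero_right cinner_sum_left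

lemma cinner_self_real: "Im (cinner x (x::'a::chilbert_space)) = 0"
  using cinner_commute[of x x] by (metis complex_cnj_cancel_iff complex_is_Real_iff Reals_cnj_iff)

lemma norm_square_eq_cinner: "(norm x)\<^sup>2 = Re (cinner x (x::'a::chilbert_space))"
proof -
  have "Re (cinner x x) \<ge> 0"
    using norm_eq_sqrt_cinner[of x] norm_ge_zero[of x] by (metis real_sqrt_ge_0_iff)
  then show ?thesis by (simp add: norm_eq_sqrt_cinner)
qed

lemma cinner_self: "cinner x x = complex_of_real ((norm (x::'a::chilbert_space))\<^sup>2)"
  by (simp add: complex_eq_iff norm_square_eq_cinner cinner_self_real)

lemma norm_scaleC: "norm (c *\<^sub>C x) = cmod c * norm (x::'a::chilbert_space)"
proof -
  have "complex_of_real ((norm (c *\<^sub>C x))\<^sup>2) = (c * cnj c) * cinner x x"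
    unfolding cinner_self[symmetric] by (simp add: cinner_simps)
  also have "\<dots> = complex_of_real ((cmod c * norm x)\<^sup>2)"
    by (simp only: complex_norm_square[symmetric] cinner_self of_real_mult of_real_power power_mult_distrib)
  finally show ?thesis by (simp only: of_real_eq_iff) simp
qed

lemma norm_add_square:
  "(norm (x + y))\<^sup>2 = (norm x)\<^sup>2 + (norm y)\<^sup>2 + 2 * Re (cinner x (y::'a::chilbert_space))"
  using cinner_commute[of x y] by (simp add: norm_square_eq_cinner cinner_simps)

lemma norm_diff_square:
  "(norm (x - y))\<^sup>2 = (norm x)\<^sup>2 + (norm y)\<^sup>2 - 2 * Re (cinner x (y::'a::chilbert_space))"
  using cinner_commute[of x y] by (simp add: norm_square_eq_cinner cinner_simps)

lemma parallelogram:
  "(norm (x + y))\<^sup>2 + (norm (x - y))\<^sup>2 = 2 * (norm x)\<^sup>2 + 2 * (norm (y::'a::chilbert_space))\<^sup>2"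
  by (simp add: norm_add_square norm_diff_square)

text \<open>Pythagoras for the component along \<open>y\<close>. Nonnegativity of the left side
  yields Cauchy-Schwarz; if subtracting multiples of \<open>y\<close> never shortens
  \<open>x\<close>, it forces \<open>cinner x y = 0\<close>.\<close>

lemma norm_diff_projection_square:
  fixes x y :: "'a::chilbert_space"
  assumes "y \<noteq> 0"
  shows "(norm (x - (cinner x y / (norm y)\<^sup>2) *\<^sub>C y))\<^sup>2 =
    (norm x)\<^sup>2 - (cmod (cinner x y))\<^sup>2 / (norm y)\<^sup>2"
proof -
  let ?c = "cinner x y / (norm y)\<^sup>2"
  have "cinner x (?c *\<^sub>C y) = complex_of_real ((cmod (cinner x y))\<^sup>2 / (norm y)\<^sup>2)"
    using complex_norm_square[of "cinner x y"] by (simp add: cinner_simps mult.commute)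
  moreover have "(norm (?c *\<^sub>C y))\<^sup>2 = (cmod (cinner x y))\<^sup>2 / (norm y)\<^sup>2"
    using assms by (simp add: norm_scaleC norm_divide norm_mult power2_eq_square)
  ultimately show ?thesis
    by (simp add: norm_diff_square del: of_real_divide of_real_power)
qed

lemma cinner_cauchy_schwarz: "cmod (cinner x y) \<le> norm x * norm (y::'a::chilbert_space)"
proof (cases "y = 0")
  case False
  have "0 \<le> (norm x)\<^sup>2 - (cmod (cinner x y))\<^sup>2 / (norm y)\<^sup>2"
    using norm_diff_projection_square[OF False, of x] zero_le_power2 by metis
  then have "(cmod (cinner x y))\<^sup>2 \<le> (norm x * norm y)\<^sup>2"
    using False by (simp add: field_simps power_mult_distrib)
  then show ?thesis by (rule power2_le_imp_le) simp
qed (simp add: cinner_simps)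

lemma cinner_eq_0_if_norm_minimal:
  fixes x y :: "'a::chilbert_space"
  assumes "\<And>c. norm x \<le> norm (x - c *\<^sub>C y)"
  shows "cinner x y = 0"
proof (cases "y = 0")
  case False
  have "(norm x)\<^sup>2 \<le> (norm x)\<^sup>2 - (cmod (cinner x y))\<^sup>2 / (norm y)\<^sup>2"
    unfolding norm_diff_projection_square[OF False, symmetric]
    by (rule power_mono[OF assms]) simp
  with False show ?thesis by (simp add: divide_le_0_iff)
qed (simp add: cinner_simps)

lemma bounded_linear_cinner_left: "bounded_linear (\<lambda>x::'a::chilbert_space. cinner x y)"
proof (rule bounded_linear_intro[where K = "norm y"])
  show "cinner (r *\<^sub>R x) y = r *\<^sub>R cinner x y" for r and x :: 'a
    by (simp add: scaleR_eq_scaleC cinner_simps scaleR_conv_of_real)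
qed (simp_all add: cinner_simps cinner_cauchy_schwarz)

lemma closed_orth_compl: "closed (orth_compl S)"
proof -
  have "orth_compl S = (\<Inter>y\<in>S. {x. cinner x y = 0})"
    by (auto simp: orth_compl_def)
  moreover have "closed {x. cinner x y = 0}" for y :: 'a
    by (intro closed_Collect_eq continuous_on_const
        linear_continuous_on[OF bounded_linear_cinner_left])
  ultimately show ?thesis by auto
qed

lemma csubspace_orth_compl: "csubspace (orth_compl S)"
  by (auto simp: cvs.subspace_def orth_compl_def cinner_simps)

lemma mem_orth_compl_orth_compl: "x \<in> S \<Longrightarrow> x \<in> orth_compl (orth_compl S)"
  using cinner_commute[of x] by (simp add: orth_compl_def)

section \<open>Bounded operators and their norms on subspaces\<close>

lemma bounded_clinearD:
  assumes "bounded_clinear T"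
  shows "T (x + y) = T x + T y" "T (x - y) = T x - T y" "T 0 = 0" "T (c *\<^sub>C x) = c *\<^sub>C T x"
    and "T (r *\<^sub>R x) = r *\<^sub>R T x" and "bounded_linear T"
  using assms by (auto simp: bounded_clinear_def linear_simps)

lemma bounded_clinear_sum:
  assumes "bounded_clinear T"
  shows "T (\<Sum>a\<in>A. f a) = (\<Sum>a\<in>A. T (f a))"
  using Real_Vector_Spaces.linear_sum[OF bounded_linear.linear] assms
  unfolding bounded_clinear_def by blast

lemma bounded_clinear_bound:
  assumes "bounded_clinear T"
  obtains c where "c \<ge> 0" "\<And>x. norm (T x) \<le> c * norm x"
  using bounded_linear.nonneg_bounded[OF bounded_clinearD(6)[OF assms]] by (metis mult.commute)

lemma scaleC_scaleR: "c *\<^sub>C r *\<^sub>R x = r *\<^sub>R c *\<^sub>C (x::'a::chilbert_space)"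
  by (simp add: scaleR_eq_scaleC scaleC_scaleC mult.commute)

lemma bounded_linear_scaleC_left: "bounded_linear (\<lambda>c. c *\<^sub>C (x::'a::chilbert_space))"
  by (rule bounded_linear_intro[where K = "norm x"])
    (simp_all add: scaleC_add_left norm_scaleC scaleR_eq_scaleC scaleC_scaleC scaleR_conv_of_real)

lemma csubspace_scaleR: "csubspace M \<Longrightarrow> x \<in> M \<Longrightarrow> r *\<^sub>R x \<in> M"
  by (simp add: scaleR_eq_scaleC cvs.subspace_scale)

lemma bounded_clinear_add:
  "bounded_clinear S \<Longrightarrow> bounded_clinear T \<Longrightarrow> bounded_clinear (\<lambda>x. S x + T x)"
  by (simp add: bounded_clinear_def bounded_linear_add scaleC_add_right)

lemma bounded_clinear_scaleR:
  "bounded_clinear T \<Longrightarrow> bounded_clinear (\<lambda>x. r *\<^sub>R T x)"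
  by (simp add: bounded_clinear_def bounded_linear_const_scaleR scaleC_scaleR)

lemma bounded_clinear_diff:
  "bounded_clinear S \<Longrightarrow> bounded_clinear T \<Longrightarrow> bounded_clinear (\<lambda>x. S x - T x)"
  using bounded_clinear_add[OF _ bounded_clinear_scaleR, of S T "-1"] by simp

lemma onorm_on_bound:
  assumes "bounded_clinear T" "x \<in> M"
  shows "norm (T x) \<le> onorm_on M T * norm x"
proof (cases "x = 0")
  case True
  then show ?thesis using assms by (simp add: bounded_clinearD)
next
  case False
  obtain c where c: "c \<ge> 0" "\<And>x. norm (T x) \<le> c * norm x"
    using bounded_clinear_bound[OF assms(1)] by blast
  have "norm (T y) / norm y \<le> c" for y
    using c by (cases "y = 0") (simp_all add: field_simps)
  then have "bdd_above ((\<lambda>x. norm (T x) / norm x) ` M)" by (rule bdd_aboveI2)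
  then have "norm (T x) / norm x \<le> onorm_on M T"
    unfolding onorm_on_def using assms(2) by (rule cSUP_upper2) simp
  then show ?thesis using False by (simp add: field_simps)
qed

lemma onorm_on_least:
  assumes "x \<in> M" "b \<ge> 0" "\<And>y. y \<in> M \<Longrightarrow> norm (T y) \<le> b * norm y"
  shows "onorm_on M T \<le> b"
  unfolding onorm_on_def
proof (rule cSUP_least)
  show "norm (T y) / norm y \<le> b" if "y \<in> M" for y
    using assms(2) assms(3)[of y] that by (cases "y = 0") (simp_all add: field_simps)
qed (use assms(1) in auto)

text \<open>By homogeneity any nonzero vector with maximal ratio will do; rescaling it gives the
  unit vector that the definition asks for.\<close>

lemma norm_attaining_onI:
  assumes T: "bounded_clinear T" and M: "csubspace M" and x: "x \<in> M" "x \<noteq> 0"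
    and max: "onorm_on M T * norm x \<le> norm (T x)"
  shows "norm_attaining_on M T"
  unfolding norm_attaining_on_def
proof (intro bexI conjI)
  let ?u = "(1 / norm x) *\<^sub>R x"
  show "?u \<in> M" using M x(1) by (rule csubspace_scaleR)
  show "norm ?u = 1" using x by simp
  have "norm (T x) = onorm_on M T * norm x"
    using max onorm_on_bound[OF T x(1)] by simp
  then show "norm (T ?u) = onorm_on M T" using x by (simp add: bounded_clinearD[OF T])
qed

lemma norm_attaining_onE:
  assumes "bounded_clinear T" "norm_attaining_on M T"
  obtains x where "x \<in> M" "norm x = 1" "\<And>y. y \<in> M \<Longrightarrow> norm (T y) \<le> norm (T x) * norm y"
  using assms onorm_on_bound unfolding norm_attaining_on_def by metis

text \<open>Subtracting a kernel vector leaves the image of \<open>x\<close> unchanged, so by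
  maximality it cannot shorten \<open>x\<close>; minimal length then means orthogonality. This takes
  the place of the projection theorem below.\<close>

lemma maximizer_orthogonal_kernel:
  assumes T: "bounded_clinear T" and M: "csubspace M" and x: "x \<in> M" "T x \<noteq> 0"
    and max: "\<And>y. y \<in> M \<Longrightarrow> norm (T y) * norm x \<le> norm (T x) * norm y"
    and n: "n \<in> M" "T n = 0"
  shows "cinner x n = 0"
proof (rule cinner_eq_0_if_norm_minimal)
  fix c
  have "x - c *\<^sub>C n \<in> M" using M x n by (simp add: cvs.subspace_diff cvs.subspace_scale)
  from max[OF this] show "norm x \<le> norm (x - c *\<^sub>C n)"
    using x n by (simp add: bounded_clinearD[OF T])
qed

section \<open>Compact perturbations\<close>

text \<open>Compactness of the restriction to \<open>M\<close>, in terms of subsequences: sums are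
  handled by thinning out twice, and every bounded operator qualifies on a finite-dimensional
  \<open>M\<close>.\<close>

definition precompact_on :: "'a::chilbert_space set \<Rightarrow> ('a \<Rightarrow> 'b::chilbert_space) \<Rightarrow> bool" where
  "precompact_on M G \<longleftrightarrow> (\<forall>x. (\<forall>n::nat. x n \<in> M \<and> norm (x n) \<le> 1) \<longrightarrow>
     (\<exists>r l. strict_mono (r::nat\<Rightarrow>nat) \<and> (\<lambda>n. G (x (r n))) \<longlonglongrightarrow> l))"

lemma precompact_onE:
  assumes "precompact_on M G" "\<And>n::nat. x n \<in> M" "\<And>n. norm (x n) \<le> 1"
  obtains r l where "strict_mono (r::nat\<Rightarrow>nat)" "(\<lambda>n. G (x (r n))) \<longlonglongrightarrow> l"
  using assms unfolding precompact_on_def by blast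

lemma precompact_on_add:
  assumes "precompact_on M G" "precompact_on M H"
  shows "precompact_on M (\<lambda>x. G x + H x)"
  unfolding precompact_on_def
proof (intro allI impI)
  fix x :: "nat \<Rightarrow> 'a" assume x: "\<forall>n. x n \<in> M \<and> norm (x n) \<le> 1"
  obtain r l where r: "strict_mono (r::nat\<Rightarrow>nat)" "(\<lambda>n. G (x (r n))) \<longlonglongrightarrow> l"
    using precompact_onE[OF assms(1), of x] x by blast
  obtain s k where s: "strict_mono (s::nat\<Rightarrow>nat)" "(\<lambda>n. H (x (r (s n)))) \<longlonglongrightarrow> k"
    using precompact_onE[OF assms(2), of "\<lambda>n. x (r n)"] x by blast
  have "(\<lambda>n. G (x (r (s n)))) \<longlonglongrightarrow> l"
    using LIMSEQ_subseq_LIMSEQ[OF r(2) s(1)] by (simp add: o_def)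
  then have "(\<lambda>n. G (x ((r \<circ> s) n)) + H (x ((r \<circ> s) n))) \<longlonglongrightarrow> l + k"
    using s(2) by (simp add: tendsto_add)
  with strict_mono_o[OF r(1) s(1)]
  show "\<exists>r l. strict_mono r \<and> (\<lambda>n. G (x (r n)) + H (x (r n))) \<longlonglongrightarrow> l" by blast
qed

lemma precompact_on_scaleR:
  assumes "precompact_on M G"
  shows "precompact_on M (\<lambda>x. a *\<^sub>R G x)"
  unfolding precompact_on_def
proof (intro allI impI)
  fix x :: "nat \<Rightarrow> 'a" assume x: "\<forall>n. x n \<in> M \<and> norm (x n) \<le> 1"
  obtain r l where r: "strict_mono (r::nat\<Rightarrow>nat)" "(\<lambda>n. G (x (r n))) \<longlonglongrightarrow> l"
    using precompact_onE[OF assms, of x] x by blast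
  then show "\<exists>r l. strict_mono r \<and> (\<lambda>n. a *\<^sub>R G (x (r n))) \<longlonglongrightarrow> l"
    using tendsto_scaleR[OF tendsto_const] by blast
qed

text \<open>Bolzano-Weierstrass for the bounded scalars \<open>f (x n)\<close>. These rank-one maps
  are the building blocks for finite rank.\<close>

lemma precompact_on_functional:
  fixes b :: "'b::chilbert_space"
  assumes "\<And>x. x \<in> M \<Longrightarrow> cmod (f x) \<le> c * norm x" "c \<ge> 0"
  shows "precompact_on M (\<lambda>x. f x *\<^sub>C b)"
  unfolding precompact_on_def
proof (intro allI impI)
  fix x :: "nat \<Rightarrow> 'a" assume x: "\<forall>n. x n \<in> M \<and> norm (x n) \<le> 1"
  have "cmod (f (x n)) \<le> c" for n
    using assms(1)[of "x n"] x mult_left_le[OF _ assms(2), of "norm (x n)"] by force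
  then have "bounded (range (\<lambda>n. f (x n)))" by (auto simp: bounded_iff)
  then obtain l r where r: "strict_mono (r::nat\<Rightarrow>nat)" "((\<lambda>n. f (x n)) \<circ> r) \<longlonglongrightarrow> l"
    using bounded_imp_convergent_subsequence by blast
  then have "(\<lambda>n. f (x (r n)) *\<^sub>C b) \<longlonglongrightarrow> l *\<^sub>C b"
    using bounded_linear.tendsto[OF bounded_linear_scaleC_left] by (simp add: o_def)
  with r(1) show "\<exists>r l. strict_mono r \<and> (\<lambda>n. f (x (r n)) *\<^sub>C b) \<longlonglongrightarrow> l" by blast
qed

lemma precompact_on_sum:
  assumes "\<And>b. b \<in> B \<Longrightarrow> precompact_on M (G b)"
  shows "precompact_on M (\<lambda>x. \<Sum>b\<in>B. G b x)"
  using assms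
\<comment> \<open>Over an infinite index set the sum is 0 by convention, so that case is as trivial
  as the empty one.\<close>
proof (induction B rule: infinite_finite_induct)
  case (insert b B)
  then show ?case by (simp add: precompact_on_add)
qed (auto simp: precompact_on_def intro: strict_monoI)

lemma precompact_on_compact_op:
  assumes "compact_op K"
  shows "precompact_on M K"
  unfolding precompact_on_def
proof (intro allI impI)
  fix x :: "nat \<Rightarrow> 'a" assume x: "\<forall>n. x n \<in> M \<and> norm (x n) \<le> 1"
  then have "bounded (range x)" by (auto simp: bounded_iff)
  then have "seq_compact (closure (K ` range x))"
    using assms by (simp add: compact_op_def compact_imp_seq_compact)
  moreover have "\<forall>n. K (x n) \<in> closure (K ` range x)"
    by (simp add: closure_subset[THEN subsetD])
  ultimately show "\<exists>r l. strict_mono r \<and> (\<lambda>n. K (x (r n))) \<longlonglongrightarrow> l"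
    unfolding seq_compact_def by (fastforce simp: o_def)
qed

section \<open>Maximizing sequences\<close>

lemma Cauchy_if_norm_square_le:
  fixes z :: "nat \<Rightarrow> 'a::real_normed_vector"
  assumes w: "w \<longlonglongrightarrow> 0" and le: "\<And>i j. (norm (z i - z j))\<^sup>2 \<le> w i + w j"
  shows "Cauchy z"
proof (rule CauchyI)
  fix e :: real assume e: "0 < e"
  then have "\<forall>\<^sub>F n in sequentially. w n < e\<^sup>2 / 2"
    by (intro order_tendstoD(2)[OF w]) simp
  then obtain N where N: "\<And>n. n \<ge> N \<Longrightarrow> w n < e\<^sup>2 / 2"
    by (auto simp: eventually_sequentially)
  have "norm (z i - z j) < e" if "i \<ge> N" "j \<ge> N" for i j
  proof (rule power2_less_imp_less)
    show "(norm (z i - z j))\<^sup>2 < e\<^sup>2" using le[of i j] N[of i] N[of j] that by linarith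
  qed (use e in simp)
  then show "\<exists>N. \<forall>i\<ge>N. \<forall>j\<ge>N. norm (z i - z j) < e" by blast
qed

lemma onorm_on_approx:
  assumes T: "bounded_clinear T" and M: "csubspace M" "M \<noteq> {0}" and e: "e > 0"
  obtains x where "x \<in> M" "norm x = 1" "onorm_on M T - e < norm (T x)"
proof (rule ccontr)
  note choose = that
  assume "\<not> thesis"
  have le: "norm (T x) \<le> onorm_on M T - e" if "x \<in> M" "norm x = 1" for x
    using choose[of x] \<open>\<not> thesis\<close> that by force
  have le': "norm (T y) \<le> (onorm_on M T - e) * norm y" if "y \<in> M" "y \<noteq> 0" for y
    using le[OF csubspace_scaleR[OF M(1) that(1)], of "1 / norm y"] that(2)
    by (simp add: bounded_clinearD[OF T] field_simps)
  \<comment> \<open>A bound on ratios must be nonnegative because the zero vector contributes the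
    value 0; any nonzero vector of \<open>M\<close> shows that it is.\<close>
  obtain x where x: "x \<in> M" "x \<noteq> 0" using M cvs.subspace_0 by blast
  have "0 \<le> (onorm_on M T - e) * norm x"
    using le'[OF x] norm_ge_zero order_trans by blast
  then have "0 \<le> onorm_on M T - e" using x by (simp add: zero_le_mult_iff)
  then have "onorm_on M T \<le> onorm_on M T - e"
    using le' x bounded_clinearD(3)[OF T] by (intro onorm_on_least[OF x(1)]) fastforce+
  then show False using e by simp
qed

text \<open>The form \<open>q x = m\<^sup>2 \<parallel>x\<parallel>\<^sup>2 - \<parallel>T x\<parallel>\<^sup>2\<close>, with \<open>m\<close> the norm of \<open>T\<close> on \<open>M\<close>, is nonnegative, so
  \<open>q (x - y) \<le> 2 q x + 2 q y\<close> by the parallelogram law. Up to terms controlled by the compact part,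
  \<open>q\<close> dominates \<open>(m\<^sup>2 - \<alpha>\<^sup>2) \<parallel>x\<parallel>\<^sup>2\<close>; hence maximizing sequences have Cauchy subsequences.\<close>

lemma norm_attaining_on_precompact_perturbation:
  fixes G V :: "'a::chilbert_space \<Rightarrow> 'b::chilbert_space"
  assumes G: "bounded_clinear G" "precompact_on M G"
    and V: "bounded_clinear V" "\<And>x. norm (V x) \<le> norm x" and \<alpha>: "\<alpha> \<ge> 0"
    and M: "csubspace M" "closed M"
    and x0: "x0 \<in> M" "x0 \<noteq> 0" "\<alpha> * norm x0 \<le> norm (G x0 + \<alpha> *\<^sub>R V x0)"
  shows "norm_attaining_on M (\<lambda>x. G x + \<alpha> *\<^sub>R V x)"
proof -
  define T where "T = (\<lambda>x. G x + \<alpha> *\<^sub>R V x)"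
  have T: "bounded_clinear T"
    unfolding T_def using G V by (intro bounded_clinear_add bounded_clinear_scaleR)
  define m where "m = onorm_on M T"
  have Tm: "norm (T x) \<le> m * norm x" if "x \<in> M" for x
    unfolding m_def by (rule onorm_on_bound[OF T that])
  \<comment> \<open>The test vector \<open>x0\<close> forces \<open>\<alpha> \<le> m\<close>; in the
    case of equality it is itself a maximizer.\<close>
  have "\<alpha> * norm x0 \<le> m * norm x0" using x0(3) Tm[OF x0(1)] by (simp add: T_def)
  then have "\<alpha> \<le> m" using x0(2) by simp
  show ?thesis
  proof (cases "\<alpha> = m")
    case True
    then show ?thesis
      using norm_attaining_onI[OF T M(1) x0(1,2)] x0(3) by (simp add: m_def T_def)
  next
    case False
    with \<open>\<alpha> \<le> m\<close> \<alpha> have gap: "m\<^sup>2 - \<alpha>\<^sup>2 > 0" by (simp add: power_strict_mono)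
    have "M \<noteq> {0}" using x0 by auto
    then have "\<exists>x. x \<in> M \<and> norm x = 1 \<and> m - 1 / Suc n < norm (T x)" for n
      using onorm_on_approx[OF T M(1), of "1 / Suc n"] unfolding m_def by auto
    then obtain x where x: "\<And>n. x n \<in> M" "\<And>n. norm (x n) = 1"
        "\<And>n. m - 1 / Suc n < norm (T (x n))" by metis
    have lim: "(\<lambda>n. norm (T (x n))) \<longlonglongrightarrow> m"
    proof (rule tendsto_sandwich)
      show "\<forall>\<^sub>F n in sequentially. m - 1 / Suc n \<le> norm (T (x n))"
        using x(3) by (simp add: less_imp_le)
      show "\<forall>\<^sub>F n in sequentially. norm (T (x n)) \<le> m" using Tm[OF x(1)] x(2) by simp
      show "(\<lambda>n. m - 1 / real (Suc n)) \<longlonglongrightarrow> m"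
        using tendsto_diff[OF tendsto_const LIMSEQ_Suc[OF lim_1_over_n], of m] by simp
    qed simp
    obtain r l where r: "strict_mono (r::nat\<Rightarrow>nat)" "(\<lambda>n. G (x (r n))) \<longlonglongrightarrow> l"
      using precompact_onE[OF G(2), of x] x by (metis order_refl)
    define z where "z = (\<lambda>n. x (r n))"
    have z: "z n \<in> M" "norm (z n) = 1" for n using x by (simp_all add: z_def)
    have limz: "(\<lambda>n. norm (T (z n))) \<longlonglongrightarrow> m"
      using LIMSEQ_subseq_LIMSEQ[OF lim r(1)] by (simp add: o_def z_def)
    obtain c where c: "c \<ge> 0" "\<And>x. norm (G x) \<le> c * norm x"
      using bounded_clinear_bound[OF G(1)] by blast
    \<comment> \<open>The share of \<open>z n\<close> in the Cauchy estimate: its defect from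
      maximality and the distance of \<open>G (z n)\<close> from its limit. For
      \<open>y = z i - z j\<close>, of norm at most 2, the factor
      \<open>2 * c + 4 * \<alpha>\<close> bounds
      \<open>norm (G y) + 2 * \<alpha> * norm y\<close>.\<close>
    define w where "w n =
      (2 * (m\<^sup>2 - (norm (T (z n)))\<^sup>2) + (2 * c + 4 * \<alpha>) * norm (G (z n) - l)) / (m\<^sup>2 - \<alpha>\<^sup>2)" for n
    have "(\<lambda>n. norm (G (z n) - l)) \<longlonglongrightarrow> 0"
      using tendsto_norm_zero[OF LIM_zero[OF r(2)]] by (simp add: z_def)
    then have "w \<longlonglongrightarrow> (2 * (m\<^sup>2 - m\<^sup>2) + (2 * c + 4 * \<alpha>) * 0) / (m\<^sup>2 - \<alpha>\<^sup>2)"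
      unfolding w_def using gap by (intro tendsto_intros limz) auto
    then have "w \<longlonglongrightarrow> 0" by simp
    moreover have "(norm (z i - z j))\<^sup>2 \<le> w i + w j" for i j
    proof -
      let ?y = "z i - z j"
      have y2: "norm ?y \<le> 2" using norm_triangle_ineq4[of "z i" "z j"] z by simp
      let ?g = "norm (G ?y)"
      have g: "?g \<le> norm (G (z i) - l) + norm (G (z j) - l)"
        using norm_triangle_ineq4[of "G (z i) - l" "G (z j) - l"] by (simp add: bounded_clinearD[OF G(1)])
      have g2: "?g \<le> 2 * c" using c(2)[of ?y] mult_left_mono[OF y2 c(1)] by simp
      have "norm (T ?y) \<le> ?g + \<alpha> * norm ?y"
        using norm_triangle_ineq[of "G ?y" "\<alpha> *\<^sub>R V ?y"] mult_left_mono[OF V(2)[of ?y] \<alpha>] \<alpha>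
        by (simp add: T_def)
      then have "(norm (T ?y))\<^sup>2 \<le> (?g + \<alpha> * norm ?y)\<^sup>2" by (intro power_mono) simp_all
      \<comment> \<open>One factor \<open>?g\<close> is split off because it is the quantity that
        becomes small.\<close>
      also have "\<dots> = \<alpha>\<^sup>2 * (norm ?y)\<^sup>2 + (?g + 2 * \<alpha> * norm ?y) * ?g"
        by (simp add: power2_eq_square algebra_simps)
      also have "(?g + 2 * \<alpha> * norm ?y) * ?g \<le> (2 * c + 4 * \<alpha>) * ?g"
        using g2 mult_left_mono[OF y2 \<alpha>] by (intro mult_right_mono) simp_all
      also have "\<dots> \<le> (2 * c + 4 * \<alpha>) * (norm (G (z i) - l) + norm (G (z j) - l))"
        using g c \<alpha> by (intro mult_left_mono) simp_all
      finally have Ty: "(norm (T ?y))\<^sup>2 \<le> \<alpha>\<^sup>2 * (norm ?y)\<^sup>2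
          + (2 * c + 4 * \<alpha>) * (norm (G (z i) - l) + norm (G (z j) - l))" by simp
      \<comment> \<open>The bound \<open>m\<close> for \<open>T\<close> at \<open>z i + z j\<close>,
        passed through the parallelogram laws for \<open>T (z i)\<close>, \<open>T (z j)\<close> and
        for \<open>z i\<close>, \<open>z j\<close>, bounds \<open>norm (T ?y)\<close> from below by
        \<open>m * norm ?y\<close> up to the defects, in squares. Comparison with \<open>Ty\<close>
        leaves the gap as the coefficient of the squared norm of \<open>?y\<close>.\<close>
      have "(norm (T (z i + z j)))\<^sup>2 \<le> (m * norm (z i + z j))\<^sup>2"
        using Tm z M(1) by (intro power_mono) (simp_all add: cvs.subspace_add)
      moreover have "(norm (T (z i + z j)))\<^sup>2 + (norm (T ?y))\<^sup>2
          = 2 * (norm (T (z i)))\<^sup>2 + 2 * (norm (T (z j)))\<^sup>2"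
        using parallelogram[of "T (z i)" "T (z j)"] by (simp add: bounded_clinearD[OF T])
      moreover have "m\<^sup>2 * ((norm (z i + z j))\<^sup>2 + (norm ?y)\<^sup>2) = m\<^sup>2 * 4"
        using parallelogram[of "z i" "z j"] z by simp
      ultimately have "(m\<^sup>2 - \<alpha>\<^sup>2) * (norm ?y)\<^sup>2 \<le> 2 * (m\<^sup>2 - (norm (T (z i)))\<^sup>2)
          + 2 * (m\<^sup>2 - (norm (T (z j)))\<^sup>2) + (2 * c + 4 * \<alpha>) * (norm (G (z i) - l) + norm (G (z j) - l))"
        using Ty by (simp add: algebra_simps power_mult_distrib)
      also have "\<dots> = (m\<^sup>2 - \<alpha>\<^sup>2) * (w i + w j)"
        using gap by (simp add: w_def divide_simps) (simp add: algebra_simps)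
      finally show ?thesis using gap by (simp del: right_diff_distrib' left_diff_distrib')
    qed
    ultimately have "Cauchy z" by (rule Cauchy_if_norm_square_le)
    then obtain u where u: "z \<longlonglongrightarrow> u" using Cauchy_convergent convergent_def by blast
    have "u \<in> M" using closed_sequentially[OF M(2) _ u] z by blast
    moreover have "norm u = 1" using tendsto_norm[OF u] z LIMSEQ_unique[OF _ tendsto_const] by simp
    moreover have "norm (T u) = m"
      using tendsto_norm[OF bounded_linear.tendsto[OF bounded_clinearD(6)[OF T] u]] limz
      by (rule LIMSEQ_unique)
    ultimately show ?thesis by (auto simp: norm_attaining_on_def m_def T_def)
  qed
qed

text \<open>The case \<open>\<alpha> = 0\<close> with zero in place of \<open>V\<close>: every
  nonzero vector of \<open>M\<close> is then a valid test vector.\<close>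

corollary norm_attaining_on_precompact:
  fixes T :: "'a::chilbert_space \<Rightarrow> 'b::chilbert_space"
  assumes T: "bounded_clinear T" "precompact_on M T"
    and M: "csubspace M" "closed M" "M \<noteq> {0}"
  shows "norm_attaining_on M T"
proof -
  obtain x0 where "x0 \<in> M" "x0 \<noteq> 0" using M cvs.subspace_0 by blast
  then show ?thesis
    using norm_attaining_on_precompact_perturbation[OF T T(1), where \<alpha> = 0, of x0]
      norm_attaining_on_precompact_perturbation[OF T, of "\<lambda>_. 0" 0 x0] M
    by (simp add: bounded_clinear_def)
qed

section \<open>Finite-dimensional and infinite-dimensional subspaces\<close>

text \<open>The spanning vectors may lie outside \<open>S\<close>, so the property passes to subsets
  at once.\<close>

definition cfinite_dim :: "'a::chilbert_space set \<Rightarrow> bool" where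
  "cfinite_dim S \<longleftrightarrow> (\<exists>C. finite C \<and> S \<subseteq> cspan C)"

text \<open>A kernel has codimension at most one: together with one vector \<open>a\<close> off the
  kernel it spans everything. The identity assumed on \<open>f\<close> is linearity in a single
  equation.\<close>

lemma cfinite_dim_kernel:
  fixes f :: "'a::chilbert_space \<Rightarrow> complex"
  assumes S: "csubspace S" and f: "\<And>c x y. f (x - c *\<^sub>C y) = f x - c * f y"
    and fin: "cfinite_dim {x\<in>S. f x = 0}"
  shows "cfinite_dim S"
proof (cases "\<forall>x\<in>S. f x = 0")
  case True
  then have "{x\<in>S. f x = 0} = S" by auto
  then show ?thesis using fin by simp
next
  case False
  then obtain a where a: "a \<in> S" "f a \<noteq> 0" by blast
  obtain C where C: "finite C" "{x\<in>S. f x = 0} \<subseteq> cspan C"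
    using fin unfolding cfinite_dim_def by blast
  have "x \<in> cspan (insert a C)" if "x \<in> S" for x
  proof -
    have "x - (f x / f a) *\<^sub>C a \<in> {x\<in>S. f x = 0}"
      using a that S by (simp add: f cvs.subspace_diff cvs.subspace_scale)
    then show ?thesis using C(2) cvs.span_breakdown_eq by blast
  qed
  then show ?thesis using C(1) unfolding cfinite_dim_def by blast
qed

text \<open>The conditions are imposed one at a time, each costing at most one dimension. With the
  identity for \<open>T\<close> they express orthogonality to \<open>B\<close>.\<close>

lemma cfinite_dim_common_kernel:
  fixes T :: "'a::chilbert_space \<Rightarrow> 'b::chilbert_space"
  assumes T: "bounded_clinear T" and "finite B" and S: "csubspace S"
    and "cfinite_dim {x\<in>S. \<forall>b\<in>B. cinner (T x) b = 0}"
  shows "cfinite_dim S"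
  using assms(2,4)
proof (induction B rule: finite_induct)
  case (insert a B)
  let ?S = "{x\<in>S. \<forall>b\<in>B. cinner (T x) b = 0}"
  have "csubspace ?S"
    using S by (auto simp: cvs.subspace_def bounded_clinearD[OF T] cinner_simps)
  moreover have "{x\<in>S. \<forall>b\<in>insert a B. cinner (T x) b = 0} = {x\<in>?S. cinner (T x) a = 0}"
    by auto
  ultimately have "cfinite_dim ?S"
    using insert.prems cfinite_dim_kernel[of ?S "\<lambda>x. cinner (T x) a"]
    by (simp add: bounded_clinearD[OF T] cinner_simps)
  then show ?case by (rule insert.IH)
qed simp

lemma infinite_dim_common_kernel:
  fixes T :: "'a::chilbert_space \<Rightarrow> 'b::chilbert_space"
  assumes "bounded_clinear T" "finite B" "csubspace S" "\<not> cfinite_dim S"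
  obtains x where "x \<in> S" "x \<noteq> 0" "\<And>b. b \<in> B \<Longrightarrow> cinner (T x) b = 0"
proof -
  \<comment> \<open>Since \<open>cspan {}\<close> is the zero space, a vector outside it is exactly
    a nonzero one.\<close>
  have "\<not> {x\<in>S. \<forall>b\<in>B. cinner (T x) b = 0} \<subseteq> cspan {}"
    using cfinite_dim_common_kernel[OF assms(1-3)] assms(4) unfolding cfinite_dim_def
    by (metis (lifting) finite.emptyI)
  then show ?thesis using that by auto
qed

lemma bounded_clinear_ident: "bounded_clinear (\<lambda>x. x)"
  by (simp add: bounded_clinear_def)

lemma infinite_orthonormal_sequence:
  fixes S :: "'a::chilbert_space set"
  assumes S: "csubspace S" "\<not> cfinite_dim S"
  obtains e :: "nat \<Rightarrow> 'a" where "\<And>n. e n \<in> S" "\<And>i j. cinner (e i) (e j) = (if i = j then 1 else 0)"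
proof -
  have "\<exists>x. x \<in> S \<and> norm x = 1 \<and> (\<forall>b\<in>B. cinner x b = 0)" if fin: "finite B" for B
  proof -
    obtain x where x: "x \<in> S" "x \<noteq> 0" "\<And>b. b \<in> B \<Longrightarrow> cinner x b = 0"
      using infinite_dim_common_kernel[OF bounded_clinear_ident fin S] by blast
    then have "(1 / norm x) *\<^sub>R x \<in> S" "norm ((1 / norm x) *\<^sub>R x) = 1"
      using csubspace_scaleR[OF S(1)] by simp_all
    moreover have "\<forall>b\<in>B. cinner ((1 / norm x) *\<^sub>R x) b = 0"
      using x(3) by (simp add: scaleR_eq_scaleC cinner_simps)
    ultimately show ?thesis by blast
  qed
  then obtain p where p: "\<And>B. finite B \<Longrightarrow> p B \<in> S \<and> norm (p B) = 1 \<and> (\<forall>b\<in>B. cinner (p B) b = 0)"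
    by metis
  \<comment> \<open>\<open>L n\<close> collects the first \<open>n\<close> vectors and
    \<open>p (L n)\<close> is the next one, a unit vector orthogonal to all of them.\<close>
  define L where "L = rec_nat {} (\<lambda>_ B. insert (p B) B)"
  have L: "L 0 = {}" "L (Suc n) = insert (p (L n)) (L n)" for n by (simp_all add: L_def)
  have fin: "finite (L n)" for n by (induction n) (simp_all add: L)
  have mem: "p (L i) \<in> L j" if "i < j" for i j
    using that by (induction j) (auto simp: L less_Suc_eq)
  have orth: "cinner (p (L i)) (p (L j)) = 0" if "j < i" for i j
    using p[OF fin[of i]] mem[OF that] by blast
  have orth': "cinner (p (L i)) (p (L j)) = 0" if "i < j" for i j
    using orth[OF that] cinner_commute[of "p (L i)"] by simp
  have "cinner (p (L i)) (p (L j)) = (if i = j then 1 else 0)" for i j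
    using orth[of j i] orth'[of i j] p[OF fin[of i]] by (cases i j rule: linorder_cases) (auto simp: cinner_self)
  then show ?thesis using that[of "\<lambda>n. p (L n)"] p[OF fin] by blast
qed

section \<open>Orthonormal bases of finite-dimensional subspaces\<close>

definition orthonormal :: "'a::chilbert_space set \<Rightarrow> bool" where
  "orthonormal B \<longleftrightarrow> (\<forall>x\<in>B. \<forall>y\<in>B. cinner x y = (if x = y then 1 else 0))"

lemma cinner_orthonormal_sum:
  assumes "finite B" "orthonormal B" "b \<in> B"
  shows "cinner (\<Sum>v\<in>B. u v *\<^sub>C v) b = u b"
proof -
  have "cinner (\<Sum>v\<in>B. u v *\<^sub>C v) b = (\<Sum>v\<in>B. u v * (if v = b then 1 else 0))"
    unfolding cinner_sum_left
    by (intro sum.cong refl) (use assms in \<open>simp add: cinner_simps orthonormal_def\<close>)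
  also have "\<dots> = u b" using assms by (simp add: if_distrib cong: if_cong)
  finally show ?thesis .
qed

lemma orthonormal_expansion:
  assumes "finite B" "orthonormal B" "x \<in> cspan B"
  shows "x = (\<Sum>b\<in>B. cinner x b *\<^sub>C b)"
proof -
  obtain u where "x = (\<Sum>b\<in>B. u b *\<^sub>C b)"
    using assms(3) unfolding cvs.span_finite[OF assms(1)] by blast
  then show ?thesis using cinner_orthonormal_sum[OF assms(1,2)] by simp
qed

lemma gram_schmidt:
  fixes C :: "'a::chilbert_space set"
  assumes "finite C"
  obtains B where "finite B" "orthonormal B" "cspan B = cspan C"
proof -
  have "\<exists>B. finite B \<and> orthonormal B \<and> cspan B = cspan C"
    using assms
  proof (induction C rule: finite_induct)
    case empty
    show ?case by (intro exI[of _ "{}"]) (simp add: orthonormal_def)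
  next
    case (insert a C)
    then obtain B where B: "finite B" "orthonormal B" "cspan B = cspan C" by blast
    have span: "cspan (insert a C) = cspan (insert a B)"
      using B(3) by (simp add: cvs.span_insert)
    define p where "p = (\<Sum>b\<in>B. cinner a b *\<^sub>C b)"
    have p: "p \<in> cspan B"
      unfolding p_def by (intro cvs.span_sum cvs.span_scale cvs.span_base)
    define r where "r = a - p"
    have rb: "cinner r b = 0" if "b \<in> B" for b
      unfolding r_def p_def using cinner_orthonormal_sum[OF B(1,2) that] by (simp add: cinner_simps(3))
    have br: "cinner b r = 0" if "b \<in> B" for b
      using rb[OF that] cinner_commute[of b r] by simp
    show ?case
    proof (cases "r = 0")
      case True
      then have "a \<in> cspan B" using p by (simp add: r_def)
      then have "cspan (insert a C) = cspan B" using span by (simp add: cvs.span_redundant)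
      then show ?thesis using B by blast
    next
      case False
      define s where "s = complex_of_real (1 / norm r)"
      have s: "s \<noteq> 0" using False by (simp add: s_def)
      have "cmod s * norm r = 1" using False by (simp add: s_def norm_divide)
      then have "cinner (s *\<^sub>C r) (s *\<^sub>C r) = 1" by (simp add: cinner_self norm_scaleC)
      \<comment> \<open>The residual \<open>r\<close> is orthogonal to \<open>B\<close>, while the
        new vector is not orthogonal to itself.\<close>
      moreover have "s *\<^sub>C r \<notin> B"
        using rb[of "s *\<^sub>C r"] calculation s by (auto simp: cinner_simps)
      ultimately have "orthonormal (insert (s *\<^sub>C r) B)"
        using B(2) rb br by (auto simp: orthonormal_def cinner_simps)
      moreover have "cspan (insert (s *\<^sub>C r) B) = cspan (insert a B)"
        unfolding cvs.span_eq
      proof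
        show "insert (s *\<^sub>C r) B \<subseteq> cspan (insert a B)"
          using p cvs.span_mono[of B "insert a B"] unfolding r_def
          by (auto intro!: cvs.span_scale cvs.span_diff intro: cvs.span_base)
        have "p \<in> cspan (insert (s *\<^sub>C r) B)"
          using p cvs.span_mono[of B "insert (s *\<^sub>C r) B"] by auto
        then have "inverse s *\<^sub>C (s *\<^sub>C r) + p \<in> cspan (insert (s *\<^sub>C r) B)"
          by (intro cvs.span_add cvs.span_scale[OF cvs.span_base]) simp_all
        then show "insert a B \<subseteq> cspan (insert (s *\<^sub>C r) B)"
          using s by (auto simp: scaleC_scaleC r_def intro: cvs.span_base)
      qed
      ultimately show ?thesis using B(1) span by blast
    qed
  qed
  then show ?thesis using that by blast
qed

text \<open>A maximal independent subset of \<open>S\<close> spans \<open>S\<close> and is finite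
  because it lies in the span of the finite set \<open>C\<close>; orthonormalizing it keeps the
  span.\<close>

lemma cfinite_dim_orthonormal_basis:
  fixes S :: "'a::chilbert_space set"
  assumes S: "csubspace S" "cfinite_dim S"
  obtains B where "finite B" "orthonormal B" "cspan B = S"
proof -
  obtain C where C: "finite C" "S \<subseteq> cspan C" using S unfolding cfinite_dim_def by blast
  obtain D where D: "D \<subseteq> S" "cvs.independent D" "S \<subseteq> cspan D"
    by (rule cvs.maximal_independent_subset)
  then have "finite D" using cvs.independent_span_bound[OF C(1)] C(2) by blast
  moreover have "cspan D = S" using D S cvs.span_minimal by blast
  ultimately show ?thesis using gram_schmidt that by metis
qed

lemma precompact_on_cinner:
  fixes T :: "'a::chilbert_space \<Rightarrow> 'c::chilbert_space"
  assumes "bounded_clinear T"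
  shows "precompact_on M (\<lambda>x. cinner (T x) y *\<^sub>C b)"
proof -
  obtain c where c: "c \<ge> 0" "\<And>x. norm (T x) \<le> c * norm x"
    using bounded_clinear_bound[OF assms] by blast
  have "cmod (cinner (T x) y) \<le> (c * norm y) * norm x" for x
    using order_trans[OF cinner_cauchy_schwarz mult_right_mono[OF c(2)[of x] norm_ge_zero[of y]]]
    by (simp add: mult.commute mult.left_commute)
  then show ?thesis using c by (intro precompact_on_functional[where c = "c * norm y"]) auto
qed

text \<open>This splits \<open>F\<close> into rank-one maps and describes its kernel by finitely
  many conditions \<open>cinner (F x) b = 0\<close>.\<close>

lemma finite_rank_op_expansion:
  fixes F :: "'a::chilbert_space \<Rightarrow> 'b::chilbert_space"
  assumes "finite_rank_op F"
  obtains B where "finite B" "\<And>x. F x = (\<Sum>b\<in>B. cinner (F x) b *\<^sub>C b)"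
proof -
  obtain C where "finite C" "range F \<subseteq> cspan C" using assms unfolding finite_rank_op_def by blast
  then obtain B where "finite B" "orthonormal B" "range F \<subseteq> cspan B" by (metis gram_schmidt)
  then show ?thesis using that orthonormal_expansion by blast
qed

lemma precompact_on_finite_rank_op:
  assumes "finite_rank_op F"
  shows "precompact_on M F"
proof -
  obtain B where "finite B" "\<And>x. F x = (\<Sum>b\<in>B. cinner (F x) b *\<^sub>C b)"
    using finite_rank_op_expansion[OF assms] by blast
  moreover have "precompact_on M (\<lambda>x. \<Sum>b\<in>B. cinner (F x) b *\<^sub>C b)"
    using assms by (intro precompact_on_sum precompact_on_cinner) (simp add: finite_rank_op_def)
  ultimately show ?thesis by presburger
qed

section \<open>Adjoints\<close>

text \<open>Riesz representation through norm attainment: the functional, multiplied by the fixed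
  vector \<open>y\<close>, is a rank-one operator \<open>G\<close>, which attains its norm at some
  \<open>x0\<close>. A maximizer is orthogonal to the kernel, so a multiple of it represents the
  functional.\<close>

lemma cadjoint_exists:
  fixes T :: "'a::chilbert_space \<Rightarrow> 'b::chilbert_space"
  assumes T: "bounded_clinear T"
  shows "\<exists>S. \<forall>x y. cinner (T x) y = cinner x (S y)"
proof -
  have "\<exists>z. \<forall>x. cinner (T x) y = cinner x z" for y
  proof (cases "\<forall>x. cinner (T x) y = 0")
    case True
    then show ?thesis by (intro exI[of _ 0]) (simp add: cinner_simps)
  next
    case False
    then obtain x1 where x1: "cinner (T x1) y \<noteq> 0" by blast
    then have y: "y \<noteq> 0" and "x1 \<noteq> 0" by (auto simp: cinner_simps bounded_clinearD[OF T])
    define G where "G = (\<lambda>x. cinner (T x) y *\<^sub>C y)"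
    have "bounded_linear G"
      unfolding G_def using bounded_linear_compose[OF bounded_linear_scaleC_left
        bounded_linear_compose[OF bounded_linear_cinner_left bounded_clinearD(6)[OF T]]] .
    then have G: "bounded_clinear G"
      by (simp add: bounded_clinear_def G_def bounded_clinearD[OF T] cinner_simps scaleC_scaleC)
    have "norm_attaining_on UNIV G"
      using \<open>x1 \<noteq> 0\<close> by (intro norm_attaining_on_precompact[OF G])
        (auto simp: G_def intro: precompact_on_cinner[OF T])
    then obtain x0 where x0: "norm x0 = 1" "\<And>x. norm (G x) \<le> norm (G x0) * norm x"
      by (rule norm_attaining_onE[OF G]) simp
    have "G x0 \<noteq> 0"
      using x0(2)[of x1] x1 y by (auto simp: G_def)
    then have f0: "cinner (T x0) y \<noteq> 0" by (auto simp: G_def)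
    have orth: "cinner x0 n = 0" if "cinner (T n) y = 0" for n
      using \<open>G x0 \<noteq> 0\<close> x0 that
      by (intro maximizer_orthogonal_kernel[OF G, of UNIV]) (simp_all add: G_def)
    \<comment> \<open>The scalar is fixed by the case \<open>x = x0\<close>, where
      \<open>norm x0 = 1\<close>; the conjugate appears because the form is conjugate-linear in its
      second argument.\<close>
    have "cinner (T x) y = cinner x (cnj (cinner (T x0) y) *\<^sub>C x0)" for x
    proof -
      have "cinner x0 (x - (cinner (T x) y / cinner (T x0) y) *\<^sub>C x0) = 0"
        using f0 by (intro orth) (simp add: bounded_clinearD[OF T] cinner_simps)
      then have "cinner (x - (cinner (T x) y / cinner (T x0) y) *\<^sub>C x0) x0 = 0"
        using cinner_commute complex_cnj_zero by metis
      then show ?thesis using f0 x0(1) by (simp add: cinner_simps cinner_self)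
    qed
    then show ?thesis by blast
  qed
  then show ?thesis by metis
qed

lemma cinner_cadjoint_right:
  assumes "bounded_clinear T"
  shows "cinner x (cadjoint T y) = cinner (T x) y"
proof -
  have "\<forall>x y. cinner (T x) y = cinner x (cadjoint T y)"
    unfolding cadjoint_def by (rule someI_ex[OF cadjoint_exists[OF assms]])
  then show ?thesis by simp
qed

lemma cinner_cadjoint_left:
  assumes "bounded_clinear T"
  shows "cinner (cadjoint T y) x = cinner y (T x)"
  using cinner_cadjoint_right[OF assms] cinner_commute by metis

section \<open>Absolutely norm attaining partial isometries\<close>

lemma absolutely_norm_attainingD:
  assumes "absolutely_norm_attaining T" "csubspace M" "closed M" "x \<in> M" "x \<noteq> 0"
  shows "norm_attaining_on M T"
  using assms unfolding absolutely_norm_attaining_def by blast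

text \<open>If \<open>V\<close> is not zero, its norm is attained at a unit vector, which is
  orthogonal to the kernel by maximality; \<open>V\<close> is isometric there, so the norm is
  1.\<close>

lemma partial_isometry_norm_le:
  fixes V :: "'a::chilbert_space \<Rightarrow> 'b::chilbert_space"
  assumes V: "partial_isometry V" "absolutely_norm_attaining V"
  shows "norm (V x) \<le> norm x"
proof (cases "V x = 0")
  case False
  have cl: "bounded_clinear V" using V(1) by (simp add: partial_isometry_def)
  have "x \<noteq> 0" using False bounded_clinearD(3)[OF cl] by auto
  then have "norm_attaining_on UNIV V" by (intro absolutely_norm_attainingD[OF V(2)]) auto
  then obtain x0 where x0: "norm x0 = 1" "\<And>y. norm (V y) \<le> norm (V x0) * norm y"
    by (rule norm_attaining_onE[OF cl]) simp
  have "V x0 \<noteq> 0" using x0(2)[of x] False by auto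
  then have "x0 \<in> orth_compl (null_space V)"
    using maximizer_orthogonal_kernel[OF cl, of UNIV x0] x0
    by (auto simp: orth_compl_def null_space_def)
  then have "norm (V x0) = 1" using V(1) x0(1) by (simp add: partial_isometry_def)
  then show ?thesis using x0(2)[of x] by simp
qed simp

text \<open>As \<open>V\<close> is a contraction, such an \<open>x\<close> maximizes the ratio and
  hence is orthogonal to the kernel.\<close>

lemma partial_isometry_norm_eqD:
  fixes V :: "'a::chilbert_space \<Rightarrow> 'b::chilbert_space"
  assumes V: "partial_isometry V" "absolutely_norm_attaining V" and x: "norm (V x) = norm x"
  shows "x \<in> orth_compl (null_space V)"
proof (cases "x = 0")
  case False
  have cl: "bounded_clinear V" using V(1) by (simp add: partial_isometry_def)
  show ?thesis
    using maximizer_orthogonal_kernel[OF cl, of UNIV x] False x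
      mult_right_mono[OF partial_isometry_norm_le[OF V] norm_ge_zero[of x]]
      bounded_clinearD(3)[OF cl]
    by (fastforce simp: orth_compl_def null_space_def mult.commute)
qed (simp add: orth_compl_def cinner_simps)

lemma csubspace_null_space: "bounded_clinear T \<Longrightarrow> csubspace (null_space T)"
  by (simp add: cvs.subspace_def null_space_def bounded_clinearD)

text \<open>If the two spaces contained orthonormal sequences \<open>e\<close> and \<open>f\<close>, then \<open>V\<close> would not attain its norm 1 on
  the closed span of the vectors \<open>g n = e n / (n + 1) + f n\<close>: a maximizer is orthogonal to all \<open>e n\<close>,
  and the vectors \<open>h n = e n - f n / (n + 1)\<close>, which are orthogonal to that span, make it orthogonal
  to all \<open>f n\<close> as well.\<close>

lemma absolutely_norm_attaining_partial_isometry_cases: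
  fixes V :: "'a::chilbert_space \<Rightarrow> 'b::chilbert_space"
  assumes V: "partial_isometry V" "absolutely_norm_attaining V"
  shows "cfinite_dim (null_space V) \<or> cfinite_dim (orth_compl (null_space V))"
proof (rule ccontr)
  let ?N = "null_space V"
  have cl: "bounded_clinear V" using V(1) by (simp add: partial_isometry_def)
  assume "\<not> (cfinite_dim ?N \<or> cfinite_dim (orth_compl ?N))"
  then have inf: "\<not> cfinite_dim ?N" "\<not> cfinite_dim (orth_compl ?N)" by simp_all
  obtain e :: "nat \<Rightarrow> 'a" where e: "\<And>n. e n \<in> ?N" "\<And>i j. cinner (e i) (e j) = (if i = j then 1 else 0)"
    using infinite_orthonormal_sequence[OF csubspace_null_space[OF cl] inf(1)] by blast
  obtain f :: "nat \<Rightarrow> 'a" where f: "\<And>n. f n \<in> orth_compl ?N"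
      "\<And>i j. cinner (f i) (f j) = (if i = j then 1 else 0)"
    using infinite_orthonormal_sequence[OF csubspace_orth_compl inf(2)] by blast
  have fe: "cinner (f i) (e j) = 0" for i j using f(1) e(1) by (auto simp: orth_compl_def)
  then have ef: "cinner (e j) (f i) = 0" for i j using cinner_commute[of "e j"] by simp
  \<comment> \<open>These weights tend to 0, which brings the norm of \<open>V\<close> on
    \<open>M\<close> up to 1, but never vanish, so orthogonality to \<open>e n\<close> and
    \<open>h n\<close> gives orthogonality to \<open>f n\<close>.\<close>
  define a where "a n = complex_of_real (1 / real (Suc n))" for n
  have a: "cnj (a n) = a n" "a n \<noteq> 0" for n by (simp_all add: a_def del: of_nat_Suc)
  define g where "g n = a n *\<^sub>C e n + f n" for n
  define h where "h n = e n - a n *\<^sub>C f n" for n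
  \<comment> \<open>The double complement is the closed span of the \<open>g n\<close>; in this form
    it is closed, and orthogonal to every \<open>h n\<close>, by definition.\<close>
  define M where "M = orth_compl (orth_compl (range g))"
  have g: "g n \<in> M" for n unfolding M_def by (intro mem_orth_compl_orth_compl) simp
  \<comment> \<open>Against \<open>g n\<close> the two contributions are \<open>a n\<close> and
    \<open>- a n\<close>, as \<open>a n\<close> is real; against the other \<open>g k\<close> each
    inner product is 0.\<close>
  have "h n \<in> orth_compl (range g)" for n
    by (auto simp: orth_compl_def g_def h_def cinner_simps e f fe ef a)
  then have hM: "cinner x (h n) = 0" if "x \<in> M" for x n using that by (auto simp: M_def orth_compl_def)
  have norm_f: "norm (f n) = 1" for n
    using f(2)[of n n] by (simp add: norm_eq_sqrt_cinner)
  have Vg: "norm (V (g n)) = 1" for n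
  proof -
    have "V (g n) = V (f n)" using e(1) by (simp add: g_def bounded_clinearD[OF cl] null_space_def)
    then show ?thesis using V(1) f(1) norm_f by (simp add: partial_isometry_def)
  qed
  have norm_g: "norm (g n) \<le> 1 + 1 / real (Suc n)" for n
  proof -
    have "norm (e n) = 1"
      using e(2)[of n n] by (simp add: norm_eq_sqrt_cinner)
    then have "norm (a n *\<^sub>C e n) = 1 / real (Suc n)"
      by (simp add: norm_scaleC a_def norm_divide del: of_nat_Suc)
    then show ?thesis
      using norm_triangle_ineq[of "a n *\<^sub>C e n" "f n"] norm_f[of n] unfolding g_def by simp
  qed
  have "g 0 \<noteq> 0" using Vg[of 0] bounded_clinearD(3)[OF cl] by auto
  then have "norm_attaining_on M V"
    using g[of 0] by (intro absolutely_norm_attainingD[OF V(2)])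
      (simp_all add: M_def closed_orth_compl csubspace_orth_compl)
  then obtain x where x: "x \<in> M" "norm x = 1" "\<And>y. y \<in> M \<Longrightarrow> norm (V y) \<le> norm (V x) * norm y"
    using norm_attaining_onE[OF cl] by blast
  have "1 \<le> norm (V x) * (1 + 1 / real (Suc n))" for n
    using order_trans[OF x(3)[OF g] mult_left_mono[OF norm_g norm_ge_zero]] Vg by metis
  moreover have "(\<lambda>n. norm (V x) * (1 + 1 / real (Suc n))) \<longlonglongrightarrow> norm (V x) * (1 + 0)"
    by (intro tendsto_intros LIMSEQ_Suc[OF lim_1_over_n])
  ultimately have "1 \<le> norm (V x)" using LIMSEQ_le_const by fastforce
  then have "norm (V x) = norm x" using partial_isometry_norm_le[OF V, of x] x(2) by simp
  then have "x \<in> orth_compl ?N" by (rule partial_isometry_norm_eqD[OF V])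
  then have xe: "cinner x (e n) = 0" for n using e(1) by (auto simp: orth_compl_def)
  then have "cinner x (f n) = 0" for n
    using hM[OF x(1), of n] a(2)[of n] by (simp add: h_def cinner_simps a)
  then have "cinner x (g n) = 0" for n using xe by (simp add: g_def cinner_simps)
  \<comment> \<open>Now \<open>x\<close> lies in a subspace and in its orthogonal
    complement.\<close>
  then have "x \<in> orth_compl (range g)" by (auto simp: orth_compl_def)
  then have "cinner x x = 0" using x(1) by (auto simp: M_def orth_compl_def)
  then show False using x(2) by (simp add: cinner_self)
qed

text \<open>\<open>V\<close> vanishes on the complement of an orthonormal basis \<open>B\<close> of
  \<open>orth_compl (null_space V)\<close>: a maximizer there with nonzero image would lie in the
  span of \<open>B\<close> and be orthogonal to \<open>B\<close>. Hence \<open>V\<close> is a finite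
  sum of rank-one maps.\<close>

lemma precompact_on_partial_isometry:
  fixes V :: "'a::chilbert_space \<Rightarrow> 'b::chilbert_space"
  assumes V: "partial_isometry V" "absolutely_norm_attaining V"
    and fin: "cfinite_dim (orth_compl (null_space V))"
  shows "precompact_on M V"
proof -
  have cl: "bounded_clinear V" using V(1) by (simp add: partial_isometry_def)
  obtain B where B: "finite B" "orthonormal B" "cspan B = orth_compl (null_space V)"
    using cfinite_dim_orthonormal_basis[OF csubspace_orth_compl fin] by blast
  have V0: "V x = 0" if x: "x \<in> orth_compl B" for x
  proof (rule ccontr)
    assume Vx: "V x \<noteq> 0"
    then have "x \<noteq> 0" using bounded_clinearD(3)[OF cl] by auto
    then have "norm_attaining_on (orth_compl B) V"
      by (rule absolutely_norm_attainingD[OF V(2) csubspace_orth_compl closed_orth_compl x])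
    then obtain z where z: "z \<in> orth_compl B" "norm z = 1"
        "\<And>y. y \<in> orth_compl B \<Longrightarrow> norm (V y) \<le> norm (V z) * norm y"
      using norm_attaining_onE[OF cl] by blast
    have Vz: "V z \<noteq> 0" using z(3)[OF x] Vx by auto
    \<comment> \<open>The maximizer \<open>z\<close> is compared only with vectors of
      \<open>orth_compl B\<close>, so the kernel has to be located inside that space.\<close>
    have "B \<subseteq> orth_compl (null_space V)" using B(3) cvs.span_superset by blast
    then have "null_space V \<subseteq> orth_compl B"
      using mem_orth_compl_orth_compl[of _ "null_space V"]
      by (auto simp: orth_compl_def[of B] orth_compl_def[of "orth_compl _"])
    then have "cinner z n = 0" if "n \<in> null_space V" for n
      using maximizer_orthogonal_kernel[OF cl csubspace_orth_compl z(1) Vz] z(2,3) that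
      by (auto simp: null_space_def)
    then have "z \<in> orth_compl (null_space V)" by (simp add: orth_compl_def)
    then have "z = (\<Sum>b\<in>B. cinner z b *\<^sub>C b)" using orthonormal_expansion B by blast
    also have "\<dots> = 0" using z(1) by (intro sum.neutral) (simp add: orth_compl_def)
    finally show False using z(2) by simp
  qed
  have "V x = (\<Sum>b\<in>B. cinner x b *\<^sub>C V b)" for x
  proof -
    have "x - (\<Sum>b\<in>B. cinner x b *\<^sub>C b) \<in> orth_compl B"
      using cinner_orthonormal_sum[OF B(1,2)] by (simp add: orth_compl_def cinner_simps(3))
    from V0[OF this] show ?thesis by (simp add: bounded_clinearD[OF cl] bounded_clinear_sum[OF cl])
  qed
  then have "V = (\<lambda>x. \<Sum>b\<in>B. cinner x b *\<^sub>C V b)" by blast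
  then show ?thesis
    using precompact_on_sum[of B M "\<lambda>b x. cinner x b *\<^sub>C V b"] precompact_on_cinner[OF bounded_clinear_ident]
    by metis
qed

lemma precompact_on_cfinite_dim:
  fixes T :: "'a::chilbert_space \<Rightarrow> 'b::chilbert_space"
  assumes T: "bounded_clinear T" and M: "csubspace M" "cfinite_dim M"
  shows "precompact_on M T"
proof -
  obtain B where B: "finite B" "orthonormal B" "cspan B = M"
    using cfinite_dim_orthonormal_basis[OF M] by blast
  have "T x = (\<Sum>b\<in>B. cinner x b *\<^sub>C T b)" if "x \<in> M" for x
    using arg_cong[OF orthonormal_expansion[OF B(1,2)], of x T] that
    by (simp add: B(3) bounded_clinearD[OF T] bounded_clinear_sum[OF T])
  moreover have "precompact_on M (\<lambda>x. \<Sum>b\<in>B. cinner x b *\<^sub>C T b)"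
    by (intro precompact_on_sum precompact_on_cinner bounded_clinear_ident)
  ultimately show ?thesis unfolding precompact_on_def by simp
qed

theorem theorem4p3:
  fixes K F V :: "'a::chilbert_space \<Rightarrow> 'b::chilbert_space"
    and \<alpha> :: real
  assumes "compact_op K"
    and "finite_rank_op F"
    and "\<alpha> \<ge> 0"
    and "partial_isometry V"
    and "absolutely_norm_attaining V"
    and "positive_op (\<lambda>x. cadjoint K (K x) + \<alpha> *\<^sub>R (cadjoint V (K x) + cadjoint K (V x)))"
  shows "absolutely_norm_attaining (\<lambda>x. K x - F x + \<alpha> *\<^sub>R V x)"
proof -
  have K: "bounded_clinear K" and F: "bounded_clinear F" and V: "bounded_clinear V"
    using assms(1,2,4) by (simp_all add: compact_op_def finite_rank_op_def partial_isometry_def)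
  have V_le: "norm (V x) \<le> norm x" for x using assms(4,5) by (rule partial_isometry_norm_le)
  let ?T = "\<lambda>x. K x - F x + \<alpha> *\<^sub>R V x"
  have G: "bounded_clinear (\<lambda>x. K x - F x)" using K F by (rule bounded_clinear_diff)
  have T: "bounded_clinear ?T" using G V by (intro bounded_clinear_add bounded_clinear_scaleR)
  have pG: "precompact_on M (\<lambda>x. K x - F x)" for M
    using precompact_on_add[OF precompact_on_compact_op[OF assms(1)]
      precompact_on_scaleR[OF precompact_on_finite_rank_op[OF assms(2)]], of M "-1"] by simp
  \<comment> \<open>The square of the right side, expanded, is the quadratic form of the positivity
    hypothesis plus the square of the left side.\<close>
  have lower: "\<alpha> * norm (V x) \<le> norm (K x + \<alpha> *\<^sub>R V x)" for x
  proof (rule power2_le_imp_le)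
    have "0 \<le> Re (cinner (cadjoint K (K x) + \<alpha> *\<^sub>R (cadjoint V (K x) + cadjoint K (V x))) x)"
      using assms(6) by (simp add: positive_op_def complex_nonneg_Reals_iff)
    also have "\<dots> = (norm (K x))\<^sup>2 + 2 * \<alpha> * Re (cinner (K x) (V x))"
      using cinner_commute[of "V x" "K x"]
      by (simp add: scaleR_eq_scaleC cinner_simps cinner_cadjoint_left[OF K] cinner_cadjoint_left[OF V]
          norm_square_eq_cinner)
    also have "\<dots> = (norm (K x + \<alpha> *\<^sub>R V x))\<^sup>2 - (\<alpha> * norm (V x))\<^sup>2"
      by (simp add: norm_add_square scaleR_eq_scaleC cinner_simps norm_scaleC power_mult_distrib)
    finally show "(\<alpha> * norm (V x))\<^sup>2 \<le> (norm (K x + \<alpha> *\<^sub>R V x))\<^sup>2" by simp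
  qed simp
  have "norm_attaining_on M ?T" if M: "csubspace M" "closed M" "M \<noteq> {0}" for M
  proof -
    \<comment> \<open>With finite-dimensional \<open>M\<close> split off, a finite-dimensional
      kernel is paired with an infinite-dimensional \<open>M\<close>, where finitely many linear
      conditions still leave a nonzero vector.\<close>
    consider "cfinite_dim M" | "cfinite_dim (orth_compl (null_space V))"
      | "\<not> cfinite_dim M" "cfinite_dim (null_space V)"
      using absolutely_norm_attaining_partial_isometry_cases[OF assms(4,5)] by blast
    then show ?thesis
    proof cases
      case 1
      show ?thesis by (rule norm_attaining_on_precompact[OF T precompact_on_cfinite_dim[OF T M(1) 1] M])
    next
      case 2
      then have "precompact_on M ?T"
        by (intro precompact_on_add[OF pG] precompact_on_scaleR precompact_on_partial_isometry[OF assms(4,5)])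
      then show ?thesis by (intro norm_attaining_on_precompact[OF T _ M])
    next
      case 3
      obtain B where B: "finite B" "orthonormal B" "cspan B = null_space V"
        using cfinite_dim_orthonormal_basis[OF csubspace_null_space[OF V] 3(2)] by blast
      obtain C where C: "finite C" "\<And>x. F x = (\<Sum>b\<in>C. cinner (F x) b *\<^sub>C b)"
        using finite_rank_op_expansion[OF assms(2)] by blast
      let ?M = "M \<inter> orth_compl B"
      have "?M = {x\<in>M. \<forall>b\<in>B. cinner x b = 0}" by (auto simp: orth_compl_def)
      then have "\<not> cfinite_dim ?M"
        using cfinite_dim_common_kernel[OF bounded_clinear_ident B(1) M(1)] 3(1) by metis
      then obtain x where x: "x \<in> ?M" "x \<noteq> 0" "\<And>b. b \<in> C \<Longrightarrow> cinner (F x) b = 0"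
        using infinite_dim_common_kernel[OF F C(1) cvs.subspace_inter[OF M(1) csubspace_orth_compl]]
        by blast
      have "F x = 0" by (subst C(2)) (simp add: x(3))
      have "cinner x y = 0" if "y \<in> null_space V" for y
      proof -
        have "y \<in> cspan B" using that B(3) by simp
        moreover have "B \<subseteq> orth_compl {x}"
          using x(1) by (auto simp: orth_compl_def) (metis cinner_commute complex_cnj_zero)
        ultimately have "y \<in> orth_compl {x}"
          using cvs.span_minimal[OF _ csubspace_orth_compl] by blast
        then show ?thesis using cinner_commute[of x y] by (simp add: orth_compl_def)
      qed
      then have "norm (V x) = norm x"
        using assms(4) by (simp add: partial_isometry_def orth_compl_def)
      \<comment> \<open>At this \<open>x\<close> the finite rank term vanishes and \<open>V\<close>
        is isometric, so the lower bound for \<open>K\<close> plus \<open>\<alpha>\<close> times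
        \<open>V\<close> makes \<open>x\<close> a test vector for the whole operator.\<close>
      then have "\<alpha> * norm x \<le> norm (?T x)" using lower[of x] \<open>F x = 0\<close> by simp
      then show ?thesis
        using x by (intro norm_attaining_on_precompact_perturbation[OF G pG V V_le assms(3) M(1,2)]) auto
    qed
  qed
  then show ?thesis using T unfolding absolutely_norm_attaining_def by blast
qed

end
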